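(* The total cost of the Greedy algorithm for the Two-Stage Robust Matching Bottleneck problem (TSRMB) can be $\Omega(m)\cdot OPT$, where $m=|R_1|$. That is, there is an absolute constant $c>0$ such that for every integer $m\ge 1$ there is an instance of TSRMB with $|R_1|=m$ on which the solution $D_1$ chosen by Greedy satisfies $f(D_1)\ge c\,m\cdot OPT$ with $OPT>0$.
   Context: TSRMB: an instance consists of finite sets $D$ (drivers), $R_1$ (first-stage riders, $m=|R_1|$), $R_2$ (potential second-stage riders), a nonempty family $\mathcal{S}$ of subsets of $R_2$ (scenarios), and a metric $d$ on $V=R_1\cup R_2\cup D$. It is assumed that there are enough drivers: $|D|\ge |R_1|+\max_{S\in\mathcal{S}}|S|$. A feasible solution is a set $D_1\subseteq D$ with $|D_1|=|R_1|$. Define $cost_1(D_1,R_1)=\frac1m\sum_{(i,j)\in M_1}d(i,j)$, where $M_1$ is a minimum-weight perfect matching between $R_1$ and $D_1$. For a set of drivers $A$ and a scenario $S$, $cost_2(A,S)$ is the bottleneck matching cost: the minimum, over all matchings of $A$ and $S$ covering every element of $S$, of the largest distance $d(i,j)$ of a matched pair. The objective is to minimize $f(D_1)=cost_1(D_1,R_1)+\max_{S\in\mathcal{S}}cost_2(D\setminus D_1,S)$; the optimal value is $OPT$. The Greedy algorithm ignores the second stage: it returns a set $D_1\subseteq D$, $|D_1|=|R_1|$, minimizing $cost_1(D_1,R_1)$. *)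

theory Defs
  imports "HOL-Analysis.Analysis"
begin

text \<open>
  The sets of first-stage riders, second-stage riders and drivers are taken to be disjoint, and
  \<^locale>\<open>Metric_space\<close> demands a proper metric: distinct points have positive distance.
\<close>

locale tsrmb =
  Metric_space "R\<^sub>1 \<union> R\<^sub>2 \<union> D" d
  for D R\<^sub>1 R\<^sub>2 :: "'v set" and \<S> :: "'v set set" and d :: "'v \<Rightarrow> 'v \<Rightarrow> real" +
  assumes finite_drivers: "finite D"
    and finite_riders1: "finite R\<^sub>1"
    and finite_riders2: "finite R\<^sub>2"
    and disjoint_riders: "R\<^sub>1 \<inter> R\<^sub>2 = {}"
    and disjoint_drivers: "(R\<^sub>1 \<union> R\<^sub>2) \<inter> D = {}"
    and scenarios_nonempty: "\<S> \<noteq> {}"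
    and scenarios_subset: "\<S> \<subseteq> Pow R\<^sub>2"
    and enough_drivers: "card D \<ge> card R\<^sub>1 + Max (card ` \<S>)"

definition matching :: "'v set \<Rightarrow> 'v set \<Rightarrow> ('v \<times> 'v) set \<Rightarrow> bool" where
  "matching A B M \<longleftrightarrow> M \<subseteq> A \<times> B \<and> inj_on fst M \<and> inj_on snd M"

definition perfect_matching :: "'v set \<Rightarrow> 'v set \<Rightarrow> ('v \<times> 'v) set \<Rightarrow> bool" where
  "perfect_matching A B M \<longleftrightarrow> matching A B M \<and> fst ` M = A \<and> snd ` M = B"

definition weight :: "('v \<Rightarrow> 'v \<Rightarrow> real) \<Rightarrow> ('v \<times> 'v) set \<Rightarrow> real" where
  "weight d M = (\<Sum>(i, j)\<in>M. d i j)"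

text \<open>
  Inserting 0 does not change the maximum of a nonempty set of distances; it makes the bottleneck
  of the empty matching, which serves the empty scenario, equal to 0.
\<close>

definition bottleneck :: "('v \<Rightarrow> 'v \<Rightarrow> real) \<Rightarrow> ('v \<times> 'v) set \<Rightarrow> real" where
  "bottleneck d M = Max (insert 0 ((\<lambda>(i, j). d i j) ` M))"

definition cost1 :: "('v \<Rightarrow> 'v \<Rightarrow> real) \<Rightarrow> 'v set \<Rightarrow> 'v set \<Rightarrow> real" where
  "cost1 d D\<^sub>1 R\<^sub>1 = 1 / real (card R\<^sub>1) * Min (weight d ` {M. perfect_matching R\<^sub>1 D\<^sub>1 M})"

definition cost2 :: "('v \<Rightarrow> 'v \<Rightarrow> real) \<Rightarrow> 'v set \<Rightarrow> 'v set \<Rightarrow> real" where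
  "cost2 d A S = Min (bottleneck d ` {M. matching A S M \<and> snd ` M = S})"

definition feasible :: "'v set \<Rightarrow> 'v set \<Rightarrow> 'v set \<Rightarrow> bool" where
  "feasible D R\<^sub>1 D\<^sub>1 \<longleftrightarrow> D\<^sub>1 \<subseteq> D \<and> card D\<^sub>1 = card R\<^sub>1"

definition total_cost ::
    "'v set \<Rightarrow> 'v set \<Rightarrow> 'v set set \<Rightarrow> ('v \<Rightarrow> 'v \<Rightarrow> real) \<Rightarrow> 'v set \<Rightarrow> real" where
  "total_cost D R\<^sub>1 \<S> d D\<^sub>1 = cost1 d D\<^sub>1 R\<^sub>1 + Max (cost2 d (D - D\<^sub>1) ` \<S>)"

definition OPT :: "'v set \<Rightarrow> 'v set \<Rightarrow> 'v set set \<Rightarrow> ('v \<Rightarrow> 'v \<Rightarrow> real) \<Rightarrow> real" where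
  "OPT D R\<^sub>1 \<S> d = Min (total_cost D R\<^sub>1 \<S> d ` {D\<^sub>1. feasible D R\<^sub>1 D\<^sub>1})"

text \<open>
  A possible output of Greedy; minimizers of the first-stage cost need not be unique, and no
  tie-breaking rule is fixed.
\<close>

definition greedy_solution ::
    "'v set \<Rightarrow> 'v set \<Rightarrow> ('v \<Rightarrow> 'v \<Rightarrow> real) \<Rightarrow> 'v set \<Rightarrow> bool" where
  "greedy_solution D R\<^sub>1 d D\<^sub>1 \<longleftrightarrow> is_arg_min (\<lambda>D'. cost1 d D' R\<^sub>1) (feasible D R\<^sub>1) D\<^sub>1"

end

theory Submission
  imports Defs
begin

text \<open>
  All points lie on a line: the drivers at 1, 6, ..., 5m + 1, the first-stage riders at
  3, 8, ..., 5m - 2, and a single second-stage rider at 0. Every rider is at distance at least 2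
  from every driver, with equality only for the driver immediately to its left, so Greedy takes
  exactly these and leaves the driver at 5m + 1 for the second stage. Matching every rider to the
  right instead costs 3 per rider and keeps the driver at 1, so the optimum is at most 4.
\<close>

section \<open>Bounds and attainment for the two stage costs\<close>

lemma finite_perfect_matchings:
  assumes "finite A" "finite B"
  shows "finite {M. perfect_matching A B M}"
proof (rule finite_subset)
  show "{M. perfect_matching A B M} \<subseteq> Pow (A \<times> B)"
    unfolding perfect_matching_def matching_def by blast
  show "finite (Pow (A \<times> B))"
    using assms by simp
qed

text \<open>Graphs of injections are the only perfect matchings that are ever built explicitly;
  \<open>weight_graph\<close> gives their weight as a sum over riders.\<close>

lemma perfect_matching_graph:
  assumes "inj_on f A"
  shows "perfect_matching A (f ` A) ((\<lambda>i. (i, f i)) ` A)"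
  using assms by (auto simp: perfect_matching_def matching_def inj_on_def image_image)

lemma weight_graph: "weight d ((\<lambda>i. (i, f i)) ` A) = (\<Sum>i\<in>A. d i (f i))"
  unfolding weight_def by (subst sum.reindex) (auto simp: inj_on_def)

lemma perfect_matching_card: "perfect_matching A B M \<Longrightarrow> card M = card A"
  by (metis card_image matching_def perfect_matching_def)

lemma cost1_le:
  assumes "finite A" "finite B" "perfect_matching A B M"
  shows "cost1 d B A \<le> weight d M / card A"
proof -
  have "Min (weight d ` {M. perfect_matching A B M}) \<le> weight d M"
    using assms finite_perfect_matchings[of A B] by (intro Min_le) auto
  then show ?thesis
    by (simp add: cost1_def divide_right_mono)
qed

text \<open>Equal cardinalities yield a bijection, whose graph is a perfect matching. So the
  \<open>Min\<close> in \<open>cost1\<close> ranges over a nonempty finite set and is one of its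
  elements.\<close>

lemma cost1_attained:
  assumes "finite A" "finite B" "card A = card B"
  obtains M where "perfect_matching A B M" "cost1 d B A = weight d M / card A"
proof -
  obtain f where "bij_betw f A B"
    using assms finite_same_card_bij by blast
  then have "perfect_matching A B ((\<lambda>i. (i, f i)) ` A)"
    using perfect_matching_graph by (metis bij_betw_def)
  then have "Min (weight d ` {M. perfect_matching A B M}) \<in> weight d ` {M. perfect_matching A B M}"
    using assms finite_perfect_matchings[of A B] by (intro Min_in) auto
  then show ?thesis
    using that by (auto simp: cost1_def)
qed

lemma cost1_graph_le:
  assumes "finite A" "inj_on f A" "\<And>i. i \<in> A \<Longrightarrow> d i (f i) \<le> b" "A \<noteq> {}"
  shows "cost1 d (f ` A) A \<le> b"
proof -
  have "cost1 d (f ` A) A \<le> (\<Sum>i\<in>A. d i (f i)) / card A"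
    using cost1_le[OF _ _ perfect_matching_graph[OF assms(2)], of d] assms(1)
    by (simp add: weight_graph)
  also have "\<dots> \<le> (card A * b) / card A"
    using sum_bounded_above[of A "\<lambda>i. d i (f i)" b] assms(3) by (intro divide_right_mono) auto
  also have "\<dots> = b"
    using assms(1,4) by simp
  finally show ?thesis .
qed

lemma cost1_nonneg:
  assumes "finite A" "finite B" "card A = card B" "\<And>i j. 0 \<le> d i j"
  shows "0 \<le> cost1 d B A"
proof -
  obtain M where "perfect_matching A B M" "cost1 d B A = weight d M / card A"
    using assms(1-3) by (rule cost1_attained)
  then show ?thesis
    using assms(4) by (auto simp: weight_def intro!: divide_nonneg_nonneg sum_nonneg)
qed

text \<open>A matching that covers a single point and is injective on second components is a single
  pair, so only the choice of driver remains. The \<open>max 0\<close> comes from the 0 inserted in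
  \<open>bottleneck\<close>.\<close>

lemma cost2_singleton: "cost2 d A {s} = Min ((\<lambda>a. max 0 (d a s)) ` A)"
proof -
  have "{M. matching A {s} M \<and> snd ` M = {s}} = (\<lambda>a. {(a, s)}) ` A"
  proof (intro set_eqI iffI; clarsimp)
    fix M assume M: "matching A {s} M" "snd ` M = {s}"
    then obtain a where a: "(a, s) \<in> M"
      by force
    have sub: "M \<subseteq> A \<times> {s}" and inj: "inj_on snd M"
      using M(1) by (auto simp: matching_def)
    have "x = (a, s)" if "x \<in> M" for x
      using inj_onD[OF inj _ that a] that sub by auto
    then have "M = {(a, s)}"
      using a by blast
    then show "M \<in> (\<lambda>a. {(a, s)}) ` A"
      using sub by blast
  qed (auto simp: matching_def)
  then show ?thesis
    by (simp add: cost2_def bottleneck_def image_image)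
qed

section \<open>Attainment of the optimum and existence of a Greedy output\<close>

lemma finite_feasible: "finite D \<Longrightarrow> finite {D\<^sub>1. feasible D R D\<^sub>1}"
  by (simp add: feasible_def)

lemma feasible_nonempty:
  assumes "card R \<le> card D"
  shows "{D\<^sub>1. feasible D R D\<^sub>1} \<noteq> {}"
  using obtain_subset_with_card_n[OF assms] by (auto simp: feasible_def)

lemma OPT_attained:
  assumes "finite D" "card R \<le> card D"
  obtains D\<^sub>1 where "feasible D R D\<^sub>1" "OPT D R \<S> d = total_cost D R \<S> d D\<^sub>1"
proof -
  have "OPT D R \<S> d \<in> total_cost D R \<S> d ` {D\<^sub>1. feasible D R D\<^sub>1}"
    unfolding OPT_def
    using finite_feasible[OF assms(1)] feasible_nonempty[OF assms(2)] by (intro Min_in) auto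
  then show ?thesis
    by (elim imageE) (use that in blast)
qed

lemma OPT_le:
  assumes "finite D" "feasible D R D\<^sub>1"
  shows "OPT D R \<S> d \<le> total_cost D R \<S> d D\<^sub>1"
  unfolding OPT_def using assms finite_feasible[OF assms(1)] by (intro Min_le) auto

text \<open>Keeps the final bound on all Greedy outputs from holding vacuously.\<close>

lemma ex_greedy_solution:
  assumes "finite D" "card R \<le> card D"
  shows "\<exists>D\<^sub>1. greedy_solution D R d D\<^sub>1"
  using ex_is_arg_min_if_finite[OF finite_feasible[OF assms(1)] feasible_nonempty[OF assms(2)],
      of "\<lambda>D'. cost1 d D' R"]
  by (simp add: greedy_solution_def)

section \<open>The instance on the line\<close>

text \<open>The period 5 = 2 + 3 places each rider at distance 2 from its left driver and 3 from its
  right one. The strict inequality rules out ties, and the residues 1 and 3 modulo 5 keep the two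
  sets disjoint.\<close>

definition line_drivers :: "nat \<Rightarrow> nat set" where
  "line_drivers m = (\<lambda>i. 5 * i + 1) ` {..m}"

definition line_riders :: "nat \<Rightarrow> nat set" where
  "line_riders m = (\<lambda>i. 5 * i + 3) ` {..<m}"

definition line_dist :: "nat \<Rightarrow> nat \<Rightarrow> real" where
  "line_dist x y = \<bar>real x - real y\<bar>"

lemma line_finite [simp]: "finite (line_drivers m)" "finite (line_riders m)"
  by (simp_all add: line_drivers_def line_riders_def)

lemma line_card [simp]: "card (line_drivers m) = m + 1" "card (line_riders m) = m"
  by (simp_all add: line_drivers_def line_riders_def card_image inj_on_def)

lemma line_tsrmb: "tsrmb (line_drivers m) (line_riders m) {0} {{0}} line_dist"
proof unfold_locales
  show "(line_riders m \<union> {0}) \<inter> line_drivers m = {}"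
  proof -
    have "5 * i + 3 \<noteq> 5 * j + (1::nat)" for i j
      by presburger
    then show ?thesis
      by (auto simp: line_riders_def line_drivers_def)
  qed
qed (auto simp: line_dist_def line_riders_def line_drivers_def card_image inj_on_def)

text \<open>The signed distance is congruent to 2 modulo 5. The element of that class with the
  smallest absolute value is 2 itself, followed by -3, so equality forces the rider and driver
  indices to agree.\<close>

lemma line_dist_rider_driver:
  assumes "x \<in> line_riders m" "y \<in> line_drivers m"
  shows "2 \<le> line_dist x y" "line_dist x y = 2 \<Longrightarrow> y = x - 2"
proof -
  obtain i j where ij: "x = 5 * i + 3" "y = 5 * j + 1"
    using assms by (auto simp: line_riders_def line_drivers_def)
  \<comment> \<open>Passing to integers turns both claims into linear arithmetic that
    \<open>presburger\<close> decides.\<close>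
  have *: "line_dist x y = of_int \<bar>5 * (int i - int j) + 2\<bar>"
    by (simp add: ij line_dist_def)
  show "2 \<le> line_dist x y"
    unfolding * by (subst of_int_numeral_le_iff) presburger
  show "y = x - 2" if "line_dist x y = 2"
  proof -
    have "\<bar>5 * (int i - int j) + 2\<bar> = 2"
      using that unfolding * by linarith
    then have "i = j"
      by presburger
    then show ?thesis
      by (simp add: ij)
  qed
qed

lemma line_left_drivers: "(\<lambda>x. x - 2) ` line_riders m = line_drivers m - {5 * m + 1}"
  by (auto simp: line_riders_def line_drivers_def image_image image_iff le_less)

lemma line_right_drivers: "(\<lambda>x. x + 3) ` line_riders m = line_drivers m - {1}"
proof -
  \<comment> \<open>The driver to the right of rider i has index i + 1, since 5i + 3 + 3 = 5(i + 1)
    + 1; only driver 0, at 1, is left over.\<close>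
  have "{..m} - {0} = Suc ` {..<m}"
    by (auto simp: image_Suc_lessThan)
  moreover have "line_drivers m - {1} = (\<lambda>i. 5 * i + 1) ` ({..m} - {0})"
    by (auto simp: line_drivers_def)
  ultimately show ?thesis
    by (simp add: line_riders_def image_image add.commute)
qed

lemma line_feasible_left: "feasible (line_drivers m) (line_riders m) (line_drivers m - {5 * m + 1})"
  by (auto simp: feasible_def card_Diff_singleton_if) (auto simp: line_drivers_def)

lemma line_feasible_right: "feasible (line_drivers m) (line_riders m) (line_drivers m - {1})"
  by (auto simp: feasible_def card_Diff_singleton_if) (auto simp: line_drivers_def)

section \<open>Greedy output and optimum on the line\<close>

text \<open>The left matching has average cost at most 2, while no pair costs less than 2. A
  minimizer therefore has every pair at exactly 2, which determines its drivers; the result is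
  independent of tie-breaking.\<close>

lemma line_greedy_unique:
  assumes "m \<ge> 1" "greedy_solution (line_drivers m) (line_riders m) line_dist D\<^sub>1"
  shows "D\<^sub>1 = line_drivers m - {5 * m + 1}"
proof -
  let ?R = "line_riders m" and ?D = "line_drivers m"
  have ne: "?R \<noteq> {}"
    using assms(1) line_card(2)[of m] by fastforce
  have feas: "D\<^sub>1 \<subseteq> ?D" "card D\<^sub>1 = m"
    and min: "cost1 line_dist D\<^sub>1 ?R \<le> cost1 line_dist (?D - {5 * m + 1}) ?R"
    using assms(2) line_feasible_left[of m]
    by (auto simp: greedy_solution_def is_arg_min_linorder feasible_def)
  have "finite D\<^sub>1"
    using feas(1) by (rule finite_subset) simp
  then obtain M where M: "perfect_matching ?R D\<^sub>1 M"
    and cost: "cost1 line_dist D\<^sub>1 ?R = weight line_dist M / card ?R"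
    using feas(2) cost1_attained[of ?R D\<^sub>1] by auto
  have sub: "M \<subseteq> ?R \<times> D\<^sub>1" and img: "fst ` M = ?R" "snd ` M = D\<^sub>1"
    using M by (auto simp: perfect_matching_def matching_def)
  have finM: "finite M"
    using sub \<open>finite D\<^sub>1\<close> finite_subset by fastforce
  have ge2: "2 \<le> line_dist x y" if "(x, y) \<in> M" for x y
    using that sub feas(1) line_dist_rider_driver(1) by blast
  have "cost1 line_dist (?D - {5 * m + 1}) ?R \<le> 2"
    unfolding line_left_drivers[symmetric] using ne
    by (intro cost1_graph_le) (auto simp: line_riders_def line_dist_def inj_on_def)
  then have "weight line_dist M / m \<le> 2"
    using min cost by simp
  then have "weight line_dist M \<le> 2 * m"
    using assms(1) by (simp add: divide_le_eq)
  \<comment> \<open>Since \<open>M\<close> has m pairs, subtracting 2 from each uses up the whole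
    bound 2m. The remaining excesses are nonnegative, so each of them vanishes.\<close>
  then have "(\<Sum>(x, y)\<in>M. line_dist x y - 2) \<le> 0"
    using perfect_matching_card[OF M]
    by (simp add: weight_def case_prod_unfold sum_subtractf)
  then have "(\<Sum>(x, y)\<in>M. line_dist x y - 2) = 0"
    using ge2 by (intro antisym sum_nonneg) auto
  then have eq2: "line_dist x y = 2" if "(x, y) \<in> M" for x y
    using sum_nonneg_0[OF finM, of "\<lambda>(x, y). line_dist x y - 2" "(x, y)"] ge2 that by auto
  have "y = x - 2" if "(x, y) \<in> M" for x y
  proof (rule line_dist_rider_driver(2))
    show "x \<in> ?R" "y \<in> ?D"
      using that sub feas(1) by auto
  qed (rule eq2[OF that])
  then have "snd ` M = (\<lambda>x. x - 2) ` fst ` M"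
    unfolding image_image by (intro image_cong) auto
  then show ?thesis
    using img line_left_drivers by simp
qed

lemma line_OPT_le:
  assumes "m \<ge> 1"
  shows "OPT (line_drivers m) (line_riders m) {{0}} line_dist \<le> 4"
proof -
  let ?R = "line_riders m" and ?D = "line_drivers m"
  have ne: "?R \<noteq> {}"
    using assms line_card(2)[of m] by fastforce
  have "cost1 line_dist (?D - {1}) ?R \<le> 3"
    unfolding line_right_drivers[symmetric] using ne
    by (intro cost1_graph_le) (auto simp: line_dist_def inj_on_def)
  moreover have "?D - (?D - {1}) = {1}"
    by (auto simp: line_drivers_def)
  then have "cost2 line_dist (?D - (?D - {1})) {0} = 1"
    by (simp add: cost2_singleton line_dist_def)
  ultimately have "total_cost ?D ?R {{0}} line_dist (?D - {1}) \<le> 4"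
    by (simp add: total_cost_def)
  then show ?thesis
    using OPT_le[OF line_finite(1) line_feasible_right] order_trans by blast
qed

text \<open>The second-stage rider sits at 0, so its distance to a driver is that driver's
  coordinate; the first-stage cost is only bounded below by 0.\<close>

lemma line_total_cost_ge:
  assumes "feasible (line_drivers m) (line_riders m) D\<^sub>1"
    and "\<And>x. x \<in> line_drivers m - D\<^sub>1 \<Longrightarrow> b \<le> real x"
  shows "b \<le> total_cost (line_drivers m) (line_riders m) {{0}} line_dist D\<^sub>1"
proof -
  have fin: "finite D\<^sub>1" and card: "card D\<^sub>1 = m" and sub: "D\<^sub>1 \<subseteq> line_drivers m"
    using assms(1) by (auto simp: feasible_def intro: finite_subset[OF _ line_finite(1)])
  have "0 \<le> cost1 line_dist D\<^sub>1 (line_riders m)"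
    using fin card by (intro cost1_nonneg) (auto simp: line_dist_def)
  \<comment> \<open>One of the m + 1 drivers is always left, so the \<open>Min\<close> in
    \<open>cost2_singleton\<close> is over a nonempty set.\<close>
  moreover have "line_drivers m - D\<^sub>1 \<noteq> {}"
    using card line_card(1)[of m] card_mono[OF fin, of "line_drivers m"] by auto
  then have "b \<le> cost2 line_dist (line_drivers m - D\<^sub>1) {0}"
    using assms(2) by (simp add: cost2_singleton line_dist_def)
  ultimately show ?thesis
    by (simp add: total_cost_def)
qed

lemma line_OPT_pos: "0 < OPT (line_drivers m) (line_riders m) {{0}} line_dist"
proof -
  obtain D\<^sub>1 where "feasible (line_drivers m) (line_riders m) D\<^sub>1"
    and opt: "OPT (line_drivers m) (line_riders m) {{0}} line_dist =
      total_cost (line_drivers m) (line_riders m) {{0}} line_dist D\<^sub>1"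
    by (rule OPT_attained[of "line_drivers m" "line_riders m"]) auto
  \<comment> \<open>Every driver has coordinate at least 1, whichever of them remains.\<close>
  then have "1 \<le> total_cost (line_drivers m) (line_riders m) {{0}} line_dist D\<^sub>1"
    by (intro line_total_cost_ge) (auto simp: line_drivers_def)
  then show ?thesis
    using opt by simp
qed

theorem lemma1:
  shows "\<exists>c::real. c > 0 \<and> (\<forall>m::nat. m \<ge> 1 \<longrightarrow>
    (\<exists>(D::nat set) R\<^sub>1 R\<^sub>2 \<S> d.
       tsrmb D R\<^sub>1 R\<^sub>2 \<S> d \<and> card R\<^sub>1 = m \<and> OPT D R\<^sub>1 \<S> d > 0 \<and>
       (\<exists>D\<^sub>1. greedy_solution D R\<^sub>1 d D\<^sub>1) \<and>
       (\<forall>D\<^sub>1. greedy_solution D R\<^sub>1 d D\<^sub>1 \<longrightarrow>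
          total_cost D R\<^sub>1 \<S> d D\<^sub>1 \<ge> c * real m * OPT D R\<^sub>1 \<S> d)))"
proof (rule exI[of _ 1], intro conjI allI impI)
  fix m :: nat assume m: "m \<ge> 1"
  let ?R = "line_riders m" and ?D = "line_drivers m"
  have "1 * real m * OPT ?D ?R {{0}} line_dist \<le> total_cost ?D ?R {{0}} line_dist D\<^sub>1"
    if "greedy_solution ?D ?R line_dist D\<^sub>1" for D\<^sub>1
  proof -
    have D\<^sub>1: "D\<^sub>1 = ?D - {5 * m + 1}"
      using line_greedy_unique m that by blast
    \<comment> \<open>The constant 1 suffices: the optimum is at most 4, while the only driver
      Greedy leaves is at 5m + 1, and 4m \<le> 5m + 1.\<close>
    have "real m * OPT ?D ?R {{0}} line_dist \<le> real m * 4"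
      using line_OPT_le[OF m] by (intro mult_left_mono) auto
    also have "\<dots> \<le> 5 * real m + 1"
      by simp
    also have "\<dots> \<le> total_cost ?D ?R {{0}} line_dist D\<^sub>1"
      unfolding D\<^sub>1 by (intro line_total_cost_ge line_feasible_left) auto
    finally show ?thesis
      by simp
  qed
  then show "\<exists>(D::nat set) R\<^sub>1 R\<^sub>2 \<S> d.
       tsrmb D R\<^sub>1 R\<^sub>2 \<S> d \<and> card R\<^sub>1 = m \<and> OPT D R\<^sub>1 \<S> d > 0 \<and>
       (\<exists>D\<^sub>1. greedy_solution D R\<^sub>1 d D\<^sub>1) \<and>
       (\<forall>D\<^sub>1. greedy_solution D R\<^sub>1 d D\<^sub>1 \<longrightarrow>
          total_cost D R\<^sub>1 \<S> d D\<^sub>1 \<ge> 1 * real m * OPT D R\<^sub>1 \<S> d)"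
    using line_tsrmb line_OPT_pos ex_greedy_solution[of ?D ?R line_dist]
    by - (rule exI[of _ ?D], rule exI[of _ ?R], rule exI[of _ "{0}"], rule exI[of _ "{{0}}"],
      rule exI[of _ line_dist], simp)
qed simp

end
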